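(* Let $u:(0,\infty)\to\mathbb{R}$ be a utility function, let $(\Omega,\Sigma)$ be a measurable space and let $\mu,\nu$ be probability measures on $(\Omega,\Sigma)$. Let $\nu=\nu_{\perp}+\nu_{\ll}$ be the Lebesgue decomposition of $\nu$ into the singular part $\nu_{\perp}$ and the absolutely continuous part $\nu_{\ll}$ with respect to $\mu$. Then $$N_{u}(\nu\parallel\mu)=\nu_{\perp}(\Omega)\,u(\infty)+\nu_{\ll}(\Omega)\,N_{u}\!\left(\frac{\nu_{\ll}}{\nu_{\ll}(\Omega)}\,\Big\|\,\mu\right).$$
   Context: A utility function is a strictly concave, strictly increasing, continuously differentiable function $u:(0,\infty)\to\mathbb{R}$ such that $\lim_{x\searrow 0}u'(x)=\infty$ and $\lim_{x\nearrow\infty}u'(x)=0$. Put $u(0):=\lim_{x\searrow0}u(x)\in[-\infty,\infty)$ and $u(\infty):=\lim_{x\nearrow\infty}u(x)\in(-\infty,\infty]$. The convention $\infty\cdot 0=-\infty\cdot 0=0$ is used; in particular, if $\nu_{\ll}(\Omega)=0$, the second term on the right-hand side is read as $0$. For a probability measure $\mu$ on $(\Omega,\Sigma)$, $D(\mu)$ is the set of all measurable functions $w:\Omega\to[0,\infty)$ with $\int_\Omega w\,d\mu=1$ (actual functions, not $\mu$-a.e. equivalence classes). For probability measures $\nu,\mu$ on $(\Omega,\Sigma)$ put $\mathcal{A}(\nu,\mu):=\{w\in D(\mu): u(w)^{-}\in L^{1}(\nu)\}$, where $x^-=\max(-x,0)$, and $$N_u(\nu\parallel\mu):=\sup_{w\in\mathcal{A}(\nu,\mu)}\int_\Omega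 u(w)\,d\nu\in(-\infty,\infty].$$ *)

theory Defs
  imports "HOL-Probability.Probability"
begin

definition strictly_concave_on :: "real set \<Rightarrow> (real \<Rightarrow> real) \<Rightarrow> bool" where
  "strictly_concave_on S f \<longleftrightarrow> convex S \<and>
     (\<forall>x\<in>S. \<forall>y\<in>S. \<forall>t. x \<noteq> y \<and> 0 < t \<and> t < 1 \<longrightarrow>
        (1 - t) * f x + t * f y < f ((1 - t) * x + t * y))"

(* Functions on (0,\<infinity>) are represented by total functions on the reals;
   only the values at positive arguments are ever used. *)

definition utility_function :: "(real \<Rightarrow> real) \<Rightarrow> bool" where
  "utility_function u \<longleftrightarrow>
     strictly_concave_on {0<..} u \<and>
     strict_mono_on {0<..} u \<and>
     u C1_differentiable_on {0<..} \<and>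
     filterlim (deriv u) at_top (at_right 0) \<and>
     (deriv u \<longlongrightarrow> 0) at_top"

definition utility_at_0 :: "(real \<Rightarrow> real) \<Rightarrow> ereal" where
  "utility_at_0 u = Lim (at_right 0) (\<lambda>x. ereal (u x))"

definition utility_at_infty :: "(real \<Rightarrow> real) \<Rightarrow> ereal" where
  "utility_at_infty u = Lim at_top (\<lambda>x. ereal (u x))"

(* u on [0,\<infinity>), with the limit at 0 as its value there; only used for x \<ge> 0. *)

definition utility_ext :: "(real \<Rightarrow> real) \<Rightarrow> real \<Rightarrow> ereal" where
  "utility_ext u x = (if x > 0 then ereal (u x) else utility_at_0 u)"

(* Both limits exist in the extended reals, so Lim is not a junk value above. *)

lemma utility_tendsto_at_0:
  assumes "utility_function u"
  shows "((\<lambda>x. ereal (u x)) \<longlongrightarrow> utility_at_0 u) (at_right 0)"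
proof -
  have mono: "u x \<le> u y" if "0 < x" "x \<le> y" for x y
    using assms that unfolding utility_function_def
    by (metis (no_types, lifting) greaterThan_iff less_le_trans strict_mono_on_leD)
  have "((\<lambda>x. ereal (u x)) \<longlongrightarrow> (INF x\<in>{0<..}. ereal (u x))) (at_right 0)"
  proof (rule decreasing_tendsto)
    show "\<forall>\<^sub>F x in at_right 0. (INF x\<in>{0<..}. ereal (u x)) \<le> ereal (u x)"
      by (auto simp: eventually_at_right_less intro!: INF_lower eventually_at_rightI[of 0 1])
  next
    fix a assume "(INF x\<in>{0<..}. ereal (u x)) < a"
    then obtain y where y: "0 < y" "ereal (u y) < a"
      by (auto simp: INF_less_iff)
    show "\<forall>\<^sub>F x in at_right 0. ereal (u x) < a"
    proof (rule eventually_at_rightI[OF _ y(1)])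
      fix x assume "x \<in> {0<..<y}"
      then show "ereal (u x) < a"
        using mono[of x y] y(2) by (auto intro: le_less_trans[of _ "ereal (u y)"])
    qed
  qed
  then show ?thesis
    unfolding utility_at_0_def by (metis tendsto_Lim trivial_limit_at_right_real)
qed

lemma utility_tendsto_at_infty:
  assumes "utility_function u"
  shows "((\<lambda>x. ereal (u x)) \<longlongrightarrow> utility_at_infty u) at_top"
proof -
  have mono: "u x \<le> u y" if "0 < x" "x \<le> y" for x y
    using assms that unfolding utility_function_def
    by (metis (no_types, lifting) greaterThan_iff less_le_trans strict_mono_on_leD)
  have "((\<lambda>x. ereal (u x)) \<longlongrightarrow> (SUP x\<in>{0<..}. ereal (u x))) at_top"
  proof (rule increasing_tendsto)
    show "\<forall>\<^sub>F x in at_top. ereal (u x) \<le> (SUP x\<in>{0<..}. ereal (u x))"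
      using eventually_gt_at_top[of 0] by eventually_elim (auto intro!: SUP_upper)
  next
    fix a assume "a < (SUP x\<in>{0<..}. ereal (u x))"
    then obtain y where y: "0 < y" "a < ereal (u y)"
      by (auto simp: less_SUP_iff)
    show "\<forall>\<^sub>F x in at_top. a < ereal (u x)"
      using eventually_ge_at_top[of y]
    proof eventually_elim
      case (elim x)
      then show ?case
        using mono[of y x] y by (auto intro: less_le_trans[of _ "ereal (u y)"])
    qed
  qed
  then show ?thesis
    unfolding utility_at_infty_def by (metis tendsto_Lim trivial_limit_at_top_linorder)
qed

definition density_set :: "'a measure \<Rightarrow> ('a \<Rightarrow> real) set" where
  "density_set \<mu> = {w \<in> borel_measurable \<mu>.
     (\<forall>x\<in>space \<mu>. 0 \<le> w x) \<and> integrable \<mu> w \<and> (\<integral>x. w x \<partial>\<mu>) = 1}"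

(* e2ennreal sends negative extended reals to 0, so that e2ennreal (f x) and
   e2ennreal (- f x) are the positive and the negative part of f x. *)

definition neg_part_integrable :: "'a measure \<Rightarrow> ('a \<Rightarrow> ereal) \<Rightarrow> bool" where
  "neg_part_integrable \<nu> f \<longleftrightarrow>
     (\<lambda>x. e2ennreal (- f x)) \<in> borel_measurable \<nu> \<and> (\<integral>\<^sup>+ x. e2ennreal (- f x) \<partial>\<nu>) < \<infinity>"

(* Integral with values in (-\<infinity>,\<infinity>], for f whose negative part is integrable. *)

definition ereal_integral :: "'a measure \<Rightarrow> ('a \<Rightarrow> ereal) \<Rightarrow> ereal" where
  "ereal_integral \<nu> f =
     enn2ereal (\<integral>\<^sup>+ x. e2ennreal (f x) \<partial>\<nu>) - enn2ereal (\<integral>\<^sup>+ x. e2ennreal (- f x) \<partial>\<nu>)"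

definition admissible :: "(real \<Rightarrow> real) \<Rightarrow> 'a measure \<Rightarrow> 'a measure \<Rightarrow> ('a \<Rightarrow> real) set" where
  "admissible u \<nu> \<mu> =
     {w \<in> density_set \<mu>. neg_part_integrable \<nu> (\<lambda>x. utility_ext u (w x))}"

definition N_util :: "(real \<Rightarrow> real) \<Rightarrow> 'a measure \<Rightarrow> 'a measure \<Rightarrow> ereal" where
  "N_util u \<nu> \<mu> =
     (SUP w \<in> admissible u \<nu> \<mu>. ereal_integral \<nu> (\<lambda>x. utility_ext u (w x)))"

definition singular_wrt :: "'a measure \<Rightarrow> 'a measure \<Rightarrow> bool" where
  "singular_wrt \<mu> \<nu> \<longleftrightarrow> (\<exists>A\<in>sets \<mu>. emeasure \<mu> A = 0 \<and> emeasure \<nu> (space \<mu> - A) = 0)"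

definition lebesgue_decomposition ::
  "'a measure \<Rightarrow> 'a measure \<Rightarrow> 'a measure \<Rightarrow> 'a measure \<Rightarrow> bool" where
  "lebesgue_decomposition \<mu> \<nu> \<nu>\<^sub>s \<nu>\<^sub>a \<longleftrightarrow>
     sets \<nu>\<^sub>s = sets \<nu> \<and> sets \<nu>\<^sub>a = sets \<nu> \<and>
     (\<forall>A\<in>sets \<nu>. emeasure \<nu> A = emeasure \<nu>\<^sub>s A + emeasure \<nu>\<^sub>a A) \<and>
     singular_wrt \<mu> \<nu>\<^sub>s \<and> absolutely_continuous \<mu> \<nu>\<^sub>a"

(* The zero measure normalises to the zero measure. *)

definition normalized :: "'a measure \<Rightarrow> 'a measure" where
  "normalized \<nu> = scale_measure (1 / emeasure \<nu> (space \<nu>)) \<nu>"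

end

theory Submission
  imports Defs
begin

text \<open>
  Both parts of \<open>\<nu>\<close> live on disjoint sets: \<open>\<nu>\<^sub>s\<close> on a \<open>\<mu>\<close>-null set \<open>S\<close>, \<open>\<nu>\<^sub>a\<close> on its complement.
  A density for \<open>\<mu>\<close> may therefore be redefined on \<open>S\<close> to any constant \<open>n\<close> without changing its
  \<open>\<mu>\<close>-integral or its utility under \<open>\<nu>\<^sub>a\<close>; letting \<open>n\<close> tend to infinity, the singular part
  contributes its mass times \<open>u(\<infinity>)\<close>, which is also an upper bound because \<open>u\<close> is increasing.
\<close>

section \<open>Bounds and measurability of the extended utility\<close>

lemma utility_ext_le_utility_at_infty:
  assumes "utility_function u"
  shows "utility_ext u x \<le> utility_at_infty u"
proof -
  have mono: "u x \<le> u y" if "0 < x" "x \<le> y" for x y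
    using assms that unfolding utility_function_def
    by (metis (no_types, lifting) greaterThan_iff less_le_trans strict_mono_on_leD)
  have le: "ereal (u y) \<le> utility_at_infty u" if "0 < y" for y
  proof (rule tendsto_lowerbound[OF utility_tendsto_at_infty[OF assms]])
    show "\<forall>\<^sub>F x in at_top. ereal (u y) \<le> ereal (u x)"
      using eventually_ge_at_top[of y] by eventually_elim (use mono that in auto)
  qed simp
  have "utility_at_0 u \<le> utility_at_infty u"
  proof (rule tendsto_upperbound[OF utility_tendsto_at_0[OF assms]])
    show "\<forall>\<^sub>F x in at_right 0. ereal (u x) \<le> utility_at_infty u"
      using eventually_at_right_less[of "0::real"] by eventually_elim (rule le)
  qed simp
  then show ?thesis
    using le by (simp add: utility_ext_def)
qed

lemma utility_at_infty_gt_MInf: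
  assumes "utility_function u"
  shows "- \<infinity> < utility_at_infty u"
  using utility_ext_le_utility_at_infty[OF assms, of 1] by (auto simp: utility_ext_def)

lemma borel_measurable_utility_ext:
  assumes "utility_function u"
  shows "utility_ext u \<in> borel_measurable borel"
proof -
  have "continuous_on {0<..} u"
    using assms by (auto simp: utility_function_def intro: C1_differentiable_imp_continuous_on)
  then have [measurable]: "u \<in> borel_measurable (restrict_space borel {0<..})"
    by (rule borel_measurable_continuous_on_restrict)
  have eq: "{x::real. 0 < x} = {0<..}"
    by auto
  \<comment> \<open>The function is glued from a continuous piece on the open half-line and a
    constant on its complement, so measurability is checked on each piece.\<close>
  have "(\<lambda>x. if x > 0 then ereal (u x) else utility_at_0 u) \<in> borel_measurable borel"
    by (subst measurable_If_restrict_space_iff) (auto simp: eq)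
  then show ?thesis
    by (simp add: utility_ext_def[abs_def])
qed

section \<open>Integrals with values in the extended reals\<close>

lemma ereal_integral_mono_AE:
  assumes "AE x in M. f x \<le> g x"
  shows "ereal_integral M f \<le> ereal_integral M g"
  unfolding ereal_integral_def
\<comment> \<open>Passing from \<open>f\<close> to \<open>g\<close> enlarges the positive part and
  shrinks the negative part.\<close>
proof (rule ereal_minus_mono)
  show "enn2ereal (\<integral>\<^sup>+ x. e2ennreal (f x) \<partial>M) \<le> enn2ereal (\<integral>\<^sup>+ x. e2ennreal (g x) \<partial>M)"
    unfolding less_eq_ennreal.rep_eq[symmetric]
    by (intro nn_integral_mono_AE eventually_mono[OF assms] e2ennreal_mono) simp
  show "enn2ereal (\<integral>\<^sup>+ x. e2ennreal (- g x) \<partial>M) \<le> enn2ereal (\<integral>\<^sup>+ x. e2ennreal (- f x) \<partial>M)"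
    unfolding less_eq_ennreal.rep_eq[symmetric]
    by (intro nn_integral_mono_AE eventually_mono[OF assms] e2ennreal_mono) simp
qed

lemma ereal_integral_cong_AE:
  assumes "AE x in M. f x = g x"
  shows "ereal_integral M f = ereal_integral M g"
  using assms by (intro antisym ereal_integral_mono_AE) auto

text \<open>Source of the term mass times \<open>utility_at_infty u\<close>. The constant may be
  infinite and the mass may be 0, in which case the convention 0 * \<infinity> = 0 makes both sides
  vanish.\<close>

lemma ereal_integral_const:
  assumes "finite_measure M"
  shows "ereal_integral M (\<lambda>_. c) = ereal (measure M (space M)) * c"
proof -
  interpret finite_measure M by fact
  let ?m = "measure M (space M)"
  have e: "enn2ereal (e2ennreal d * emeasure M (space M)) = ereal ?m * max 0 d" for d
    by (cases "0 \<le> d")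
      (simp_all add: times_ennreal.rep_eq emeasure_eq_measure enn2ereal_e2ennreal e2ennreal_neg
        enn2ereal_ennreal max_def zero_ennreal.rep_eq mult.commute)
  have "ereal_integral M (\<lambda>_. c) = ereal ?m * max 0 c - ereal ?m * max 0 (- c)"
    by (simp only: ereal_integral_def nn_integral_const e)
  also have "\<dots> = ereal ?m * c"
    by (cases c; cases "?m = 0")
      (auto simp: max_def zero_ereal_def[symmetric] mult_le_0_iff zero_le_mult_iff)
  finally show ?thesis .
qed

lemma ereal_integral_gt_MInf:
  assumes "neg_part_integrable M f"
  shows "- \<infinity> < ereal_integral M f"
  using assms enn2ereal_nonneg[of "\<integral>\<^sup>+ x. e2ennreal (f x) \<partial>M"]
  unfolding ereal_integral_def neg_part_integrable_def
  by (cases "\<integral>\<^sup>+ x. e2ennreal (- f x) \<partial>M"; cases "enn2ereal (\<integral>\<^sup>+ x. e2ennreal (f x) \<partial>M)")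
    (auto simp: enn2ereal_ennreal)

lemma neg_part_integrable_cong_AE:
  assumes "AE x in M. f x = g x"
    and "f \<in> borel_measurable M" "g \<in> borel_measurable M"
  shows "neg_part_integrable M f \<longleftrightarrow> neg_part_integrable M g"
proof -
  have "(\<integral>\<^sup>+ x. e2ennreal (- f x) \<partial>M) = (\<integral>\<^sup>+ x. e2ennreal (- g x) \<partial>M)"
    using assms(1) by (intro nn_integral_cong_AE) auto
  then show ?thesis
    using assms(2,3) by (simp add: neg_part_integrable_def)
qed

lemma neg_part_integrable_const:
  assumes "finite_measure M" "c \<noteq> - \<infinity>"
  shows "neg_part_integrable M (\<lambda>_. c)"
  using assms finite_measure.emeasure_finite[OF assms(1)]
  by (cases c) (auto simp: neg_part_integrable_def ennreal_mult_less_top top.not_eq_extremum e2ennreal_neg)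

section \<open>Normalising a finite measure\<close>

lemma normalized_null:
  assumes "emeasure M (space M) = 0"
  shows "emeasure (normalized M) (space (normalized M)) = 0"
  \<comment> \<open>The scaling factor is 1 / 0 = \<infinity> here, and \<infinity> * 0 = 0.\<close>
  using assms by (simp add: normalized_def space_scale_measure)

text \<open>The product form, unlike a quotient, also covers mass 0: both sides are then 0. For
  positive finite mass the scaling factor cancels.\<close>

lemma nn_integral_normalized:
  assumes "finite_measure M" "f \<in> borel_measurable M"
  shows "emeasure M (space M) * nn_integral (normalized M) f = nn_integral M f"
proof (cases "emeasure M (space M) = 0")
  case True
  then have "nn_integral M f = 0"
    using assms(2) by (intro nn_integral_zero' AE_I[of _ _ "space M"]) auto
  then show ?thesis
    using True by simp
next
  case False
  moreover have "emeasure M (space M) \<noteq> \<infinity>"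
    using finite_measure.emeasure_finite[OF assms(1)] by simp
  ultimately show ?thesis
    using assms(2)
    by (simp add: normalized_def nn_integral_scale_measure mult.assoc[symmetric]
        ennreal_times_divide ennreal_divide_self top.not_eq_extremum)
qed

lemma nn_integral_normalized_finite_iff:
  assumes "finite_measure M" "f \<in> borel_measurable M"
  shows "nn_integral (normalized M) f < \<infinity> \<longleftrightarrow> nn_integral M f < \<infinity>"
proof (cases "emeasure M (space M) = 0")
  case True
  have "nn_integral (normalized M) f = 0"
    using assms(2) normalized_null[OF True]
    by (intro nn_integral_zero' AE_I[of _ _ "space (normalized M)"]) (auto simp: normalized_def space_scale_measure)
  moreover have "nn_integral M f = 0"
    using assms(2) True by (intro nn_integral_zero' AE_I[of _ _ "space M"]) auto
  ultimately show ?thesis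
    by simp
next
  case False
  then show ?thesis
    using finite_measure.emeasure_finite[OF assms(1)] nn_integral_normalized[OF assms, symmetric]
    by (auto simp: ennreal_mult_less_top top.not_eq_extremum)
qed

lemma ereal_integral_normalized:
  assumes "finite_measure M" "f \<in> borel_measurable M"
  shows "ereal (measure M (space M)) * ereal_integral (normalized M) f = ereal_integral M f"
proof -
  interpret finite_measure M by fact
  have m: "enn2ereal (emeasure M (space M)) = ereal (measure M (space M))"
    by (simp add: emeasure_eq_measure enn2ereal_ennreal)
  have e: "enn2ereal (nn_integral M g)
      = ereal (measure M (space M)) * enn2ereal (nn_integral (normalized M) g)"
    if "g \<in> borel_measurable M" for g
    using nn_integral_normalized[OF assms(1) that, symmetric] m
    by (simp add: times_ennreal.rep_eq)
  \<comment> \<open>Distributivity is checked by cases because infinite values occur; even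
    \<open>a = b = \<infinity>\<close> is covered, since \<infinity> - \<infinity> evaluates to
    \<infinity>.\<close>
  have "ereal r * (a - b) = ereal r * a - ereal r * b" if "0 \<le> r" "0 \<le> a" "0 \<le> b" for r a b
    using that by (cases a; cases b) (auto simp: algebra_simps)
  then show ?thesis
    using assms(2) by (simp add: ereal_integral_def e)
qed

text \<open>Makes the index set of the supremum nonempty, so that constants can be multiplied into
  it and added to it.\<close>

lemma one_in_admissible:
  assumes "prob_space \<mu>" "finite_measure \<nu>"
  shows "(\<lambda>_. 1) \<in> admissible u \<nu> \<mu>"
proof -
  interpret prob_space \<mu> by fact
  show ?thesis
    using neg_part_integrable_const[OF assms(2), of "ereal (u 1)"]
    by (simp add: admissible_def density_set_def prob_space utility_ext_def)
qed

lemma borel_measurable_utility_density: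
  assumes "utility_function u" "w \<in> density_set \<mu>" "sets \<nu> = sets \<mu>"
  shows "(\<lambda>x. utility_ext u (w x)) \<in> borel_measurable \<nu>"
proof -
  have "w \<in> borel_measurable \<nu>"
    using assms(2) measurable_cong_sets[OF assms(3) refl] by (auto simp: density_set_def)
  then show ?thesis
    using borel_measurable_utility_ext[OF assms(1)] by (rule measurable_compose)
qed

text \<open>Normalising changes neither sign nor finiteness of the integrals, so the admissible
  densities stay the same, and the finite nonnegative mass moves inside the supremum. The main
  argument can thus work with \<open>\<nu>\<^sub>a\<close> itself, whether or not its mass is
  0.\<close>

lemma N_util_normalized:
  assumes "utility_function u" "prob_space \<mu>" "finite_measure \<nu>" "sets \<nu> = sets \<mu>"
  shows "ereal (measure \<nu> (space \<nu>)) * N_util u (normalized \<nu>) \<mu> = N_util u \<nu> \<mu>"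
proof -
  note meas = borel_measurable_utility_density[OF assms(1) _ assms(4)]
  have sets: "sets (normalized \<nu>) = sets \<nu>"
    by (simp add: normalized_def)
  have adm: "admissible u (normalized \<nu>) \<mu> = admissible u \<nu> \<mu>"
    using nn_integral_normalized_finite_iff[OF assms(3)] meas
    by (auto simp: admissible_def neg_part_integrable_def measurable_cong_sets[OF sets refl])
  show ?thesis
    unfolding N_util_def adm
    using one_in_admissible[OF assms(2,3), of u] ereal_integral_normalized[OF assms(3)] meas
    by (subst Sup_ereal_mult_left') (auto simp: admissible_def intro!: SUP_cong)
qed

section \<open>Integration against a sum of two measures\<close>

lemma nn_integral_add_measure:
  assumes sets: "sets M1 = sets M" "sets M2 = sets M"
    and add: "\<And>A. A \<in> sets M \<Longrightarrow> emeasure M A = emeasure M1 A + emeasure M2 A"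
    and f: "f \<in> borel_measurable M"
  shows "nn_integral M f = nn_integral M1 f + nn_integral M2 f"
proof -
  have meas: "g \<in> borel_measurable M1" "g \<in> borel_measurable M2"
    if "g \<in> borel_measurable M" for g :: "'a \<Rightarrow> ennreal"
    using that measurable_cong_sets[OF sets(1) refl] measurable_cong_sets[OF sets(2) refl] by auto
  show ?thesis
    using f
  proof induction
    case (cong f g)
    moreover have "nn_integral N f = nn_integral N g" if "space N = space M" for N
      using cong(3) that by (intro nn_integral_cong) simp
    ultimately show ?case
      using sets_eq_imp_space_eq[OF sets(1)] sets_eq_imp_space_eq[OF sets(2)] by simp
  next
    case (set A)
    then show ?case
      by (simp add: sets add)
  next
    case (mult f c)
    then show ?case
      by (simp add: nn_integral_cmult meas distrib_left)
  next
    case (add f g)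
    then show ?case
      by (simp add: nn_integral_add meas algebra_simps)
  next
    case (seq F)
    \<comment> \<open>Both sequences of integrals increase, which lets the supremum of their sums
      split into the sum of their suprema.\<close>
    have inc: "incseq (\<lambda>i. nn_integral N (F i))" for N
      using seq(3) by (auto simp: incseq_def le_fun_def intro!: nn_integral_mono)
    have "nn_integral N (SUP i. F i) = (SUP i. nn_integral N (F i))"
      if "\<And>i. F i \<in> borel_measurable N" for N
      using nn_integral_monotone_convergence_SUP[OF seq(3) that]
      by (simp add: SUP_apply[abs_def])
    then show ?case
      using seq(1,4) seq.IH meas[OF seq(1)] inc
      by (simp add: ennreal_SUP_add del: Sup_apply SUP_apply)
  qed
qed

lemma neg_part_integrable_add_measure:
  assumes sets: "sets M1 = sets M" "sets M2 = sets M"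
    and add: "\<And>A. A \<in> sets M \<Longrightarrow> emeasure M A = emeasure M1 A + emeasure M2 A"
  shows "neg_part_integrable M f \<longleftrightarrow> neg_part_integrable M1 f \<and> neg_part_integrable M2 f"
  using nn_integral_add_measure[OF assms, of "\<lambda>x. e2ennreal (- f x)"]
    measurable_cong_sets[OF sets(1) refl] measurable_cong_sets[OF sets(2) refl]
  by (auto simp: neg_part_integrable_def)

lemma ereal_integral_add_measure:
  assumes sets: "sets M1 = sets M" "sets M2 = sets M"
    and add: "\<And>A. A \<in> sets M \<Longrightarrow> emeasure M A = emeasure M1 A + emeasure M2 A"
    and f: "f \<in> borel_measurable M" "neg_part_integrable M f"
  shows "ereal_integral M f = ereal_integral M1 f + ereal_integral M2 f"
proof -
  have e: "nn_integral M (\<lambda>x. e2ennreal (g x))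
      = nn_integral M1 (\<lambda>x. e2ennreal (g x)) + nn_integral M2 (\<lambda>x. e2ennreal (g x))"
    if "g \<in> borel_measurable M" for g
    using that by (intro nn_integral_add_measure[OF sets add]) auto
  \<comment> \<open>Finite \<open>c\<close> and \<open>d\<close>, the integrals of the negative
    parts, rule out \<infinity> - \<infinity>, so the terms may be regrouped even if
    \<open>a\<close> or \<open>b\<close> is infinite.\<close>
  have alg: "enn2ereal (a + b) - enn2ereal (c + d)
      = (enn2ereal a - enn2ereal c) + (enn2ereal b - enn2ereal d)"
    if "c < \<infinity>" "d < \<infinity>" for a b c d
    using that
    by (cases a; cases b; cases c; cases d)
      (auto simp: plus_ennreal.rep_eq enn2ereal_ennreal)
  show ?thesis
    using f neg_part_integrable_add_measure[OF sets add, of f]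
    unfolding ereal_integral_def
    by (simp add: e neg_part_integrable_def alg)
qed

theorem theorem2p12:
  fixes u :: "real \<Rightarrow> real"
    and \<mu> \<nu> \<nu>\<^sub>s \<nu>\<^sub>a :: "'a measure"
  assumes "utility_function u"
    and "prob_space \<mu>"
    and "prob_space \<nu>"
    and "sets \<nu> = sets \<mu>"
    and "lebesgue_decomposition \<mu> \<nu> \<nu>\<^sub>s \<nu>\<^sub>a"
  shows "N_util u \<nu> \<mu> =
           ereal (measure \<nu>\<^sub>s (space \<nu>\<^sub>s)) * utility_at_infty u
         + ereal (measure \<nu>\<^sub>a (space \<nu>\<^sub>a)) * N_util u (normalized \<nu>\<^sub>a) \<mu>"
proof -
  interpret \<mu>: prob_space \<mu> by fact
  interpret \<nu>: prob_space \<nu> by fact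
  let ?I = "\<lambda>M w. ereal_integral M (\<lambda>x. utility_ext u (w x))"
  let ?a = "ereal (measure \<nu>\<^sub>s (space \<nu>\<^sub>s))"
  have sets: "sets \<nu>\<^sub>s = sets \<nu>" "sets \<nu>\<^sub>a = sets \<nu>"
    and add: "\<And>A. A \<in> sets \<nu> \<Longrightarrow> emeasure \<nu> A = emeasure \<nu>\<^sub>s A + emeasure \<nu>\<^sub>a A"
    and sing: "singular_wrt \<mu> \<nu>\<^sub>s" and ac: "absolutely_continuous \<mu> \<nu>\<^sub>a"
    using assms(5) by (auto simp: lebesgue_decomposition_def)
  have sets': "sets \<nu>\<^sub>s = sets \<mu>" "sets \<nu>\<^sub>a = sets \<mu>"
    using sets assms(4) by auto
  note space = sets_eq_imp_space_eq[OF assms(4)] sets'[THEN sets_eq_imp_space_eq]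
  \<comment> \<open>Finiteness of the two parts is read off from their total mass 1.\<close>
  have "emeasure \<nu>\<^sub>s (space \<nu>) + emeasure \<nu>\<^sub>a (space \<nu>) = 1"
    using add[of "space \<nu>"] \<nu>.emeasure_space_1 by simp
  then have "emeasure \<nu>\<^sub>s (space \<nu>\<^sub>s) \<noteq> \<infinity>" "emeasure \<nu>\<^sub>a (space \<nu>\<^sub>a) \<noteq> \<infinity>"
    by (auto simp: space)
  then have fin_s: "finite_measure \<nu>\<^sub>s" and fin_a: "finite_measure \<nu>\<^sub>a"
    by (auto intro: finite_measureI)
  obtain S where S: "S \<in> sets \<mu>" "emeasure \<mu> S = 0" "emeasure \<nu>\<^sub>s (space \<mu> - S) = 0"
    using sing by (auto simp: singular_wrt_def)
  have AE_s: "AE x in \<nu>\<^sub>s. x \<in> S"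
    using S by (intro AE_I[of _ _ "space \<mu> - S"]) (auto simp: sets' space)
  have AE_\<mu>: "AE x in \<mu>. x \<notin> S"
    using S by (intro AE_I[of _ _ S]) auto
  have "S \<in> null_sets \<nu>\<^sub>a"
    using ac S by (auto simp: absolutely_continuous_def null_sets_def)
  then have AE_a: "AE x in \<nu>\<^sub>a. x \<notin> S"
    by (rule AE_not_in)
  note meas = borel_measurable_utility_density[OF assms(1)]
  \<comment> \<open>Needed twice below: for continuity of addition in the limit, and for moving this
    summand inside a supremum.\<close>
  have a_u_inf: "?a * utility_at_infty u \<noteq> - \<infinity>"
    using utility_at_infty_gt_MInf[OF assms(1)]
    by (auto simp: ereal_mult_eq_MInfty not_less measure_le_0_iff)

  have upper: "N_util u \<nu> \<mu> \<le> ?a * utility_at_infty u + N_util u \<nu>\<^sub>a \<mu>"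
    unfolding N_util_def[of u \<nu>]
  proof (rule SUP_least)
    fix w assume w: "w \<in> admissible u \<nu> \<mu>"
    then have wd: "w \<in> density_set \<mu>" and wi: "neg_part_integrable \<nu> (\<lambda>x. utility_ext u (w x))"
      by (auto simp: admissible_def)
    have "w \<in> admissible u \<nu>\<^sub>a \<mu>"
      using wd wi neg_part_integrable_add_measure[OF sets add] by (auto simp: admissible_def)
    then have "?I \<nu>\<^sub>a w \<le> N_util u \<nu>\<^sub>a \<mu>"
      unfolding N_util_def by (rule SUP_upper)
    moreover have "?I \<nu>\<^sub>s w \<le> ?a * utility_at_infty u"
      \<comment> \<open>Rewriting the product as the integral of a constant turns the bound into a
        pointwise one.\<close>
      unfolding ereal_integral_const[OF fin_s, symmetric]
      by (intro ereal_integral_mono_AE AE_I2 utility_ext_le_utility_at_infty assms(1))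
    ultimately show "?I \<nu> w \<le> ?a * utility_at_infty u + N_util u \<nu>\<^sub>a \<mu>"
      using ereal_integral_add_measure[OF sets add meas[OF wd assms(4)] wi]
      by (simp add: add_mono)
  qed

  have step: "?a * utility_at_infty u + ?I \<nu>\<^sub>a w \<le> N_util u \<nu> \<mu>"
    if w: "w \<in> admissible u \<nu>\<^sub>a \<mu>" for w
  proof -
    have wd: "w \<in> density_set \<mu>" and wi: "neg_part_integrable \<nu>\<^sub>a (\<lambda>x. utility_ext u (w x))"
      using w by (auto simp: admissible_def)
    have w_borel: "w \<in> borel_measurable \<mu>"
      using wd by (simp add: density_set_def)
    have bound: "?a * ereal (u t) + ?I \<nu>\<^sub>a w \<le> N_util u \<nu> \<mu>" if t: "0 < t" for t :: real
    proof -
      \<comment> \<open>\<open>v\<close> is \<open>\<mu>\<close>-a.e. and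
        \<open>\<nu>\<^sub>a\<close>-a.e. equal to \<open>w\<close>, but constantly \<open>t\<close>
        where \<open>\<nu>\<^sub>s\<close> lives. Positivity of \<open>t\<close> keeps
        \<open>v\<close> nonnegative and its utility on \<open>S\<close> finite.\<close>
      define v where "v x = (if x \<in> S then t else w x)" for x
      have v_borel: "v \<in> borel_measurable \<mu>"
        unfolding v_def using S(1) w_borel by measurable
      have v_\<mu>: "AE x in \<mu>. v x = w x"
        using AE_\<mu> by eventually_elim (simp add: v_def)
      have vd: "v \<in> density_set \<mu>"
        using wd t v_borel integrable_cong_AE[OF v_borel w_borel v_\<mu>]
          integral_cong_AE[OF v_borel w_borel v_\<mu>]
        by (simp add: density_set_def) (simp add: v_def)
      have v_a: "AE x in \<nu>\<^sub>a. utility_ext u (v x) = utility_ext u (w x)"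
        using AE_a by eventually_elim (simp add: v_def)
      have v_s: "AE x in \<nu>\<^sub>s. utility_ext u (v x) = ereal (u t)"
        using AE_s by eventually_elim (simp add: v_def utility_ext_def t)
      have "neg_part_integrable \<nu>\<^sub>a (\<lambda>x. utility_ext u (v x))"
        using wi neg_part_integrable_cong_AE[OF v_a meas meas] vd wd sets' by auto
      moreover have "neg_part_integrable \<nu>\<^sub>s (\<lambda>x. utility_ext u (v x))"
        using neg_part_integrable_const[OF fin_s, of "ereal (u t)"]
          neg_part_integrable_cong_AE[OF v_s meas] vd sets' by auto
      ultimately have vi: "neg_part_integrable \<nu> (\<lambda>x. utility_ext u (v x))"
        using neg_part_integrable_add_measure[OF sets add] by auto
      have "?I \<nu>\<^sub>s v = ?a * ereal (u t)"
        using ereal_integral_cong_AE[OF v_s] ereal_integral_const[OF fin_s] by metis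
      then have "?a * ereal (u t) + ?I \<nu>\<^sub>a w = ?I \<nu> v"
        using ereal_integral_add_measure[OF sets add meas[OF vd assms(4)] vi]
          ereal_integral_cong_AE[OF v_a] by simp
      also have "\<dots> \<le> N_util u \<nu> \<mu>"
        unfolding N_util_def using vd vi by (intro SUP_upper) (simp add: admissible_def)
      finally show ?thesis .
    qed
    \<comment> \<open>The limit in \<open>t\<close> is taken for fixed \<open>w\<close>, before the
      supremum over \<open>w\<close>. Addition is continuous here because neither limit is
      -\<infinity>, although either may be \<infinity>.\<close>
    have "((\<lambda>t. ?a * ereal (u t) + ?I \<nu>\<^sub>a w) \<longlongrightarrow> ?a * utility_at_infty u + ?I \<nu>\<^sub>a w) at_top"
      using a_u_inf ereal_integral_gt_MInf[OF wi] utility_tendsto_at_infty[OF assms(1)]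
      by (intro tendsto_add_ereal_general tendsto_cmult_ereal tendsto_const) auto
    then show ?thesis
      by (rule tendsto_upperbound)
        (use eventually_mono[OF eventually_gt_at_top bound] in auto)
  qed

  \<comment> \<open>The summand moves inside because the index set is nonempty and the summand is
    not -\<infinity>.\<close>
  have "?a * utility_at_infty u + N_util u \<nu>\<^sub>a \<mu>
      = (SUP w \<in> admissible u \<nu>\<^sub>a \<mu>. ?a * utility_at_infty u + ?I \<nu>\<^sub>a w)"
    unfolding N_util_def
    using one_in_admissible[OF assms(2) fin_a, of u] a_u_inf
    by (intro SUP_ereal_add_right[symmetric]) auto
  also have "\<dots> \<le> N_util u \<nu> \<mu>"
    by (rule SUP_least) (rule step)
  finally have "N_util u \<nu> \<mu> = ?a * utility_at_infty u + N_util u \<nu>\<^sub>a \<mu>"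
    using upper by (rule antisym[rotated])
  then show ?thesis
    using N_util_normalized[OF assms(1,2) fin_a sets'(2)] by simp
qed

end
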